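(* Let $G$ be a graph with $\chi(G) = 1$ and let $n \geq 1$ be a natural number. Let $\phi_{n+1} : \mathrm{Conf}_{n+1}(G) \to \mathrm{Conf}_n(G)$ be the forgetting map $(x_1, \ldots, x_{n+1}) \mapsto (x_1, \ldots, x_n)$. Then there exists a continuous map $s_n : \mathrm{Conf}_n(G) \to \mathrm{Conf}_{n+1}(G)$ with $\phi_{n+1} \circ s_n = \mathrm{id}_{\mathrm{Conf}_n(G)}$ (a section) if and only if $n \geq 2$.
   Context: A graph is a finite connected 1-dimensional cell complex; $\chi(G)$ denotes its Euler characteristic. The $n$-th ordered configuration space is $\mathrm{Conf}_n(G) = \{(x_1, \ldots, x_n) \in G^n : x_i \neq x_j \text{ for } i \neq j\}$ with the subspace topology from $G^n$. *)

theory Defs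
  imports "HOL-Analysis.Analysis"
begin

text \<open>
  A finite cell complex of dimension at most one on the space \<open>X\<close>: \<open>V\<close> is the set of 0-cells, \<open>E\<close>
  indexes the 1-cells, and \<open>\<Phi> e\<close> is the characteristic map of the 1-cell \<open>e\<close>, so that \<open>\<Phi> e 0\<close> and
  \<open>\<Phi> e 1\<close> give its attaching map. Loops and multiple edges are allowed. As there are only finitely
  many cells and \<open>X\<close> is Hausdorff, each \<open>\<Phi> e\<close> is a closed map; hence it restricts to a homeomorphism
  of the open interval onto the open 1-cell, and \<open>X\<close> carries the weak topology determined by the
  cells, neither of which therefore has to be demanded.
\<close>

definition finite_cell_complex_1 ::
  "'a topology \<Rightarrow> 'a set \<Rightarrow> 'e set \<Rightarrow> ('e \<Rightarrow> real \<Rightarrow> 'a) \<Rightarrow> bool" where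
  "finite_cell_complex_1 X V E \<Phi> \<longleftrightarrow>
     Hausdorff_space X \<and> finite V \<and> finite E \<and>
     (\<forall>e\<in>E. continuous_map (top_of_set {0..1}) X (\<Phi> e) \<and>
            \<Phi> e 0 \<in> V \<and> \<Phi> e 1 \<in> V \<and>
            inj_on (\<Phi> e) {0<..<1} \<and>
            \<Phi> e ` {0<..<1} \<inter> V = {}) \<and>
     (\<forall>e\<in>E. \<forall>e'\<in>E. e \<noteq> e' \<longrightarrow> \<Phi> e ` {0<..<1} \<inter> \<Phi> e' ` {0<..<1} = {}) \<and>
     topspace X = V \<union> (\<Union>e\<in>E. \<Phi> e ` {0<..<1})"

definition graph ::
  "'a topology \<Rightarrow> 'a set \<Rightarrow> 'e set \<Rightarrow> ('e \<Rightarrow> real \<Rightarrow> 'a) \<Rightarrow> bool" where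
  "graph X V E \<Phi> \<longleftrightarrow>
     finite_cell_complex_1 X V E \<Phi> \<and> connected_space X \<and> topspace X \<noteq> {}"

definition euler_char :: "'a set \<Rightarrow> 'e set \<Rightarrow> int" where
  "euler_char V E = int (card V) - int (card E)"

text \<open>
  A point of the \<open>n\<close>-fold power is a function on \<open>{1..n}\<close>, extended by \<open>undefined\<close>.
\<close>

definition Conf :: "nat \<Rightarrow> 'a topology \<Rightarrow> (nat \<Rightarrow> 'a) topology" where
  "Conf n X = subtopology (product_topology (\<lambda>_. X) {1..n})
     {x. \<forall>i\<in>{1..n}. \<forall>j\<in>{1..n}. i \<noteq> j \<longrightarrow> x i \<noteq> x j}"

text \<open>\<open>forget n\<close> is the map from \<open>Conf (n + 1) X\<close> to \<open>Conf n X\<close>.\<close>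

definition forget :: "nat \<Rightarrow> (nat \<Rightarrow> 'a) \<Rightarrow> nat \<Rightarrow> 'a" where
  "forget n x = restrict x {1..n}"

end

theory Submission
  imports Defs
begin

text \<open>
  A graph of Euler characteristic 1 is a tree, hence is built from a point by attaching arcs at one
  endpoint. Attaching an arc preserves the fixed point property: retract onto the old part to find
  a fixed point there, unless the attaching point is mapped into the new arc, and in that case
  retract onto the arc. A section for \<open>n = 1\<close> would be a fixed-point-free self-map. Attaching an arc
  also preserves the existence of a continuous distance with continuously varying geodesics, and
  for \<open>n \<ge> 2\<close> the new point is placed on the geodesic from \<open>x\<^sub>1\<close> to \<open>x\<^sub>2\<close>, closer to \<open>x\<^sub>1\<close> than any
  other \<open>x\<^sub>j\<close>.
\<close>

section \<open>Fixed points and geodesics\<close>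

definition fixed_point_property :: "'a topology \<Rightarrow> bool" where
  "fixed_point_property X \<longleftrightarrow> (\<forall>f. continuous_map X X f \<longrightarrow> (\<exists>x\<in>topspace X. f x = x))"

text \<open>
  \<open>G x y t\<close> is the point reached from \<open>x\<close> after travelling towards \<open>y\<close> for time \<open>t\<close> at unit speed,
  stopping at \<open>y\<close>. Neither symmetry nor the triangle inequality of \<open>d\<close> is ever needed.
\<close>

definition geodesic_structure ::
  "'a topology \<Rightarrow> ('a \<Rightarrow> 'a \<Rightarrow> real) \<Rightarrow> ('a \<Rightarrow> 'a \<Rightarrow> real \<Rightarrow> 'a) \<Rightarrow> bool" where
  "geodesic_structure X d G \<longleftrightarrow>
     continuous_map (prod_topology X X) euclideanreal (\<lambda>z. d (fst z) (snd z)) \<and>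
     continuous_map (prod_topology (prod_topology X X) (top_of_set {0..})) X
       (\<lambda>z. G (fst (fst z)) (snd (fst z)) (snd z)) \<and>
     (\<forall>x\<in>topspace X. \<forall>y\<in>topspace X.
        0 \<le> d x y \<and> (d x y = 0 \<longleftrightarrow> x = y) \<and>
        (\<forall>t\<ge>0. d x (G x y t) = min t (d x y) \<and> (d x y \<le> t \<longrightarrow> G x y t = y)))"

context
  fixes X :: "'a topology" and d G
  assumes dG: "geodesic_structure X d G"
begin

lemma geodesic_dist:
  assumes "x \<in> topspace X" "y \<in> topspace X"
  shows "0 \<le> d x y" "d x y = 0 \<longleftrightarrow> x = y"
  using dG assms by (auto simp: geodesic_structure_def)

lemma dist_geodesic:
  assumes "x \<in> topspace X" "y \<in> topspace X" "0 \<le> t"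
  shows "d x (G x y t) = min t (d x y)"
  using dG assms by (auto simp: geodesic_structure_def)

lemma geodesic_end:
  assumes "x \<in> topspace X" "y \<in> topspace X" "d x y \<le> t"
  shows "G x y t = y"
  using dG assms geodesic_dist(1)[OF assms(1,2)] unfolding geodesic_structure_def
  by (meson order_trans)

lemma continuous_map_geodesic_dist:
  assumes "continuous_map Z X f" "continuous_map Z X g"
  shows "continuous_map Z euclideanreal (\<lambda>z. d (f z) (g z))"
  using continuous_map_compose[OF continuous_map_pairedI[OF assms]] dG
  by (fastforce simp: geodesic_structure_def o_def)

lemma continuous_map_geodesic:
  assumes "continuous_map Z X f" "continuous_map Z X g"
    and "continuous_map Z euclideanreal h" "\<And>z. z \<in> topspace Z \<Longrightarrow> 0 \<le> h z"
  shows "continuous_map Z X (\<lambda>z. G (f z) (g z) (h z))"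
proof -
  have "continuous_map Z (top_of_set {0..}) h"
    using assms by (auto simp: continuous_map_in_subtopology)
  from continuous_map_compose[OF continuous_map_pairedI[OF continuous_map_pairedI[OF assms(1,2)] this]] dG
  show ?thesis
    by (fastforce simp: geodesic_structure_def o_def)
qed

lemma geodesic_in_space:
  assumes "x \<in> topspace X" "y \<in> topspace X" "0 \<le> t"
  shows "G x y t \<in> topspace X"
proof -
  \<comment> \<open>Membership is read off from continuity: with constant arguments, the map sends
    the real line into \<open>topspace X\<close>.\<close>
  have "continuous_map euclideanreal X (\<lambda>_. G x y t)"
    by (rule continuous_map_geodesic) (use assms in auto)
  then show ?thesis
    by (auto dest: continuous_map_funspace)
qed

text \<open>At time 0 the distance travelled is 0, and only \<open>x\<close> itself lies at distance
  0 from \<open>x\<close>.\<close>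

lemma geodesic_start:
  assumes "x \<in> topspace X" "y \<in> topspace X"
  shows "G x y 0 = x"
  using dist_geodesic[OF assms, of 0] geodesic_dist[OF assms]
    geodesic_dist(2)[OF assms(1) geodesic_in_space[OF assms, of 0]] by simp

end

lemma continuous_map_pasting2:
  assumes "closedin Z S" "closedin Z T" "topspace Z \<subseteq> S \<union> T"
    and "continuous_map (subtopology Z S) X f" "continuous_map (subtopology Z T) X f"
  shows "continuous_map Z X f"
  by (rule pasting_lemma_closed[of "{S, T}" Z id X "\<lambda>_. f"]) (use assms in auto)

section \<open>Attaching an arc\<close>

text \<open>The attachment is described inside \<open>X\<close> instead of as a quotient, so that
  \<open>A\<close> stays a subspace over the same type. Since \<open>A\<close> and the arc are both
  closed, continuous maps out of \<open>X\<close> can be pasted from the two pieces.\<close>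

locale arc_attached =
  fixes X :: "'a topology" and A :: "'a set" and c :: "real \<Rightarrow> 'a"
  assumes Hausdorff: "Hausdorff_space X"
    and closed: "closedin X A"
    and cont_arc: "continuous_map (top_of_set {0..1}) X c"
    and inj_arc: "inj_on c {0..1}"
    and topspace_eq: "topspace X = A \<union> c ` {0..1}"
    and inter: "A \<inter> c ` {0..1} = {c 0}"
begin

text \<open>
  The pair \<open>(retr x, height x)\<close> gives coordinates identifying \<open>X\<close> with the subset of \<open>A \<times> [0, 1]\<close>
  on which the second entry is \<open>0\<close> or the first is \<open>c 0\<close>; \<open>point\<close> is the inverse.
\<close>

definition retr :: "'a \<Rightarrow> 'a" where
  "retr x = (if x \<in> A then x else c 0)"

definition height :: "'a \<Rightarrow> real" where
  "height x = (if x \<in> A then 0 else the_inv_into {0..1} c x)"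

definition point :: "'a \<Rightarrow> real \<Rightarrow> 'a" where
  "point a s = (if s = 0 then a else c s)"

section \<open>Coordinates on a space with an arc attached\<close>

lemma base_in: "c 0 \<in> A"
  using inter by auto

lemma A_subset: "A \<subseteq> topspace X"
  using topspace_eq by auto

lemma topspace_A: "topspace (subtopology X A) = A"
  using A_subset by auto

lemma closed_arc: "closedin X (c ` {0..1})"
  by (rule compactin_imp_closedin[OF Hausdorff image_compactin[OF _ cont_arc]])
     (simp add: compactin_subtopology)

lemma arc_in_A_iff: "t \<in> {0..1} \<Longrightarrow> c t \<in> A \<longleftrightarrow> t = 0"
proof -
  assume t: "t \<in> {0..1}"
  then have "c t \<in> A \<longleftrightarrow> c t = c 0"
    using inter by blast
  then show ?thesis
    using inj_on_eq_iff[OF inj_arc t, of 0] by simp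
qed

lemma height_arc: "t \<in> {0..1} \<Longrightarrow> height (c t) = t"
  using arc_in_A_iff[of t] by (auto simp: height_def the_inv_into_f_f[OF inj_arc])

lemma retr_arc: "t \<in> {0..1} \<Longrightarrow> retr (c t) = c 0"
  using arc_in_A_iff[of t] by (auto simp: retr_def)

lemma retr_A [simp]: "a \<in> A \<Longrightarrow> retr a = a"
  and height_A [simp]: "a \<in> A \<Longrightarrow> height a = 0"
  by (simp_all add: retr_def height_def)

lemma retr_in: "retr x \<in> A"
  by (simp add: retr_def base_in)

lemma height_range: "x \<in> topspace X \<Longrightarrow> height x \<in> {0..1}"
  using topspace_eq height_arc by (cases "x \<in> A") auto

lemma height_0_or_base: "height x = 0 \<or> retr x = c 0"
  by (auto simp: retr_def height_def)

lemma point_retr_height: "x \<in> topspace X \<Longrightarrow> point (retr x) (height x) = x"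
  using topspace_eq height_arc retr_arc by (cases "x \<in> A") (auto simp: point_def)

lemma
  assumes "a \<in> A" "s \<in> {0..1}" "s = 0 \<or> a = c 0"
  shows retr_point: "retr (point a s) = a"
    and height_point: "height (point a s) = s"
  using assms topspace_eq height_arc retr_arc by (auto simp: point_def)

lemma cont_retr: "continuous_map X (subtopology X A) retr"
proof (rule continuous_map_into_subtopology)
  show "continuous_map X X retr"
  proof (rule continuous_map_pasting2[OF closed closed_arc])
    show "continuous_map (subtopology X A) X retr"
      by (rule continuous_map_eq[where f = id]) (auto simp: continuous_map_from_subtopology)
    show "continuous_map (subtopology X (c ` {0..1})) X retr"
      by (rule continuous_map_eq[where f = "\<lambda>_. c 0"])
         (use base_in A_subset in \<open>auto simp: retr_arc\<close>)
  qed (use topspace_eq in auto)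
qed (use retr_in in auto)

lemma cont_height: "continuous_map X euclideanreal height"
proof (rule continuous_map_pasting2[OF closed closed_arc])
  show "continuous_map (subtopology X A) euclideanreal height"
    by (rule continuous_map_eq[where f = "\<lambda>_. 0"]) auto
  \<comment> \<open>A continuous injection from a compact space into a Hausdorff space is an
    embedding; its continuous inverse is \<open>height\<close> on the arc.\<close>
  have "embedding_map (top_of_set {0..1}) X c"
    by (rule continuous_imp_embedding_map[OF cont_arc])
       (use Hausdorff inj_arc in \<open>auto simp: compact_space_subtopology\<close>)
  then obtain g where g: "homeomorphic_maps (top_of_set {0..1}) (subtopology X (c ` {0..1})) c g"
    by (auto simp: embedding_map_def homeomorphic_map_maps)
  then have "continuous_map (subtopology X (c ` {0..1})) euclideanreal g"
    by (auto simp: homeomorphic_maps_def continuous_map_in_subtopology)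
  then show "continuous_map (subtopology X (c ` {0..1})) euclideanreal height"
    by (rule continuous_map_eq) (use g in \<open>auto simp: homeomorphic_maps_def height_arc\<close>)
qed (use topspace_eq in auto)

text \<open>By \<open>dom\<close>, the domain is the union of the closed sets \<open>s z = 0\<close>
  and \<open>a z = c 0\<close>. On the first the value is \<open>a z\<close>, on the second it is
  \<open>c (s z)\<close>, and on the overlap both are \<open>c 0\<close>.\<close>

lemma cont_point:
  assumes a: "continuous_map Z (subtopology X A) a"
    and s: "continuous_map Z euclideanreal s"
    and dom: "\<And>z. z \<in> topspace Z \<Longrightarrow> s z \<in> {0..1} \<and> (s z = 0 \<or> a z = c 0)"
  shows "continuous_map Z X (\<lambda>z. point (a z) (s z))"
proof (rule continuous_map_pasting2)
  have aX: "continuous_map Z X a"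
    using a by (simp add: continuous_map_in_subtopology)
  let ?S = "{z \<in> topspace Z. s z \<in> {0}}" and ?T = "{z \<in> topspace Z. a z \<in> {c 0}}"
  show "closedin Z ?S"
    by (rule closedin_continuous_map_preimage[OF s]) simp
  show "closedin Z ?T"
    by (rule closedin_continuous_map_preimage[OF aX closedin_Hausdorff_singleton[OF Hausdorff]])
       (use base_in A_subset in auto)
  show "topspace Z \<subseteq> ?S \<union> ?T"
    using dom by auto
  show "continuous_map (subtopology Z ?S) X (\<lambda>z. point (a z) (s z))"
    by (rule continuous_map_eq[OF continuous_map_from_subtopology[OF aX]]) (auto simp: point_def)
  have "continuous_map Z (top_of_set {0..1}) s"
    using s dom by (auto simp: continuous_map_in_subtopology)
  from continuous_map_from_subtopology[OF continuous_map_compose[OF this cont_arc]]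
  show "continuous_map (subtopology Z ?T) X (\<lambda>z. point (a z) (s z))"
    by (rule continuous_map_eq) (auto simp: point_def)
qed

section \<open>Fixed points and geodesics after attaching an arc\<close>

lemma fixed_point_property_arc_attached:
  assumes "fixed_point_property (subtopology X A)"
  shows "fixed_point_property X"
  unfolding fixed_point_property_def
proof (intro allI impI)
  fix f
  assume f: "continuous_map X X f"
  have "continuous_map (subtopology X A) (subtopology X A) (retr \<circ> f)"
    using continuous_map_compose[OF f cont_retr] by (rule continuous_map_from_subtopology)
  with assms obtain q where q: "q \<in> A" "retr (f q) = q"
    unfolding fixed_point_property_def topspace_A by auto
  show "\<exists>x\<in>topspace X. f x = x"
  proof (cases "f q \<in> A")
    case True
    with q A_subset show ?thesis by auto
  next
    case False
    \<comment> \<open>Everything outside \<open>A\<close> is retracted to \<open>c 0\<close>, so the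
      only obstruction is that \<open>f\<close> pushes the base point into the arc.\<close>
    then have q0: "q = c 0"
      using q by (simp add: retr_def)
    have fX: "f x \<in> topspace X" if "x \<in> topspace X" for x
      using f that by (auto simp: continuous_map_def)
    have cX: "c t \<in> topspace X" if "t \<in> {0..1}" for t
      using topspace_eq that by auto
    \<comment> \<open>Read in the height coordinate, \<open>f\<close> restricted to the arc is a
      self-map of the unit interval, which has a fixed height \<open>t\<close>.\<close>
    have "continuous_on {0..1} (height \<circ> f \<circ> c)"
      using continuous_map_compose[OF cont_arc continuous_map_compose[OF f cont_height]]
      by (simp add: o_assoc)
    moreover have "(height \<circ> f \<circ> c) ` {0..1} \<subseteq> {0..1}"
      using height_range fX cX by fastforce
    ultimately obtain t where t: "t \<in> {0..1}" "height (f (c t)) = t"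
      using brouwer[of "{0..1}" "height \<circ> f \<circ> c"] by (auto simp: Pi_iff image_subset_iff)
    \<comment> \<open>Height 0 only says that a point is in \<open>A\<close>, whereas a positive
      height determines the point. Here \<open>t = 0\<close> would put \<open>f q\<close> back into
      \<open>A\<close>.\<close>
    have "t \<noteq> 0"
    proof
      assume "t = 0"
      with t q0 have "point (retr (f q)) (height (f q)) = retr (f q)"
        by (simp add: point_def)
      then have "f q = retr (f q)"
        using point_retr_height[OF fX] q A_subset by (metis subsetD)
      with False retr_in show False by metis
    qed
    then have "f (c t) = c t"
      using point_retr_height[OF fX[OF cX[OF t(1)]]] t by (simp add: point_def)
    with cX t show ?thesis by auto
  qed
qed

text \<open>In the coordinates \<open>(retr x, height x)\<close> the sum of the two coordinate
  distances is the length of the natural path: the two coordinates vary one at a time, and the path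
  switches between them at \<open>c 0\<close>.\<close>

lemma geodesic_structure_arc_attached:
  assumes dG: "geodesic_structure (subtopology X A) d G"
  shows "\<exists>d' G'. geodesic_structure X d' G'"
proof -
  define d' where "d' x y = d (retr x) (retr y) + \<bar>height x - height y\<bar>" for x y
  \<comment> \<open>Descend from \<open>x\<close> to the base, travel inside \<open>A\<close>, and climb to \<open>y\<close>; the formulas also cover the
     direct path between two points of the arc, where both retractions coincide.\<close>
  define ga where "ga x y t = G (retr x) (retr y) (max (t - height x) 0)" for x y t
  define gh where "gh x y t =
    max (max (height x - t) (min (height y) (height x + t - d (retr x) (retr y)))) 0" for x y t
  define G' where "G' x y t = point (ga x y t) (gh x y t)" for x y t
  have in_A: "retr x \<in> topspace (subtopology X A)" for x
    by (simp only: topspace_A retr_in)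
  have ga_in: "ga x y t \<in> A" for x y t
    using geodesic_in_space[OF dG in_A in_A] unfolding ga_def topspace_A by simp
  have gh_range: "gh x y t \<in> {0..1}" if "x \<in> topspace X" "y \<in> topspace X" "0 \<le> t" for x y t
    using that height_range[of x] height_range[of y] by (auto simp: gh_def)
  \<comment> \<open>The geodesic axioms for \<open>G'\<close>, stated in coordinates. The first
    conjunct says that the pair \<open>(ga, gh)\<close> really comes from a point of
    \<open>X\<close>; only then can \<open>retr\<close> and \<open>height\<close> of
    \<open>G' x y t\<close> be evaluated.\<close>
  have key: "(gh x y t = 0 \<or> ga x y t = c 0) \<and>
             d (retr x) (ga x y t) + \<bar>height x - gh x y t\<bar> = min t (d' x y) \<and>
             (d' x y \<le> t \<longrightarrow> ga x y t = retr y \<and> gh x y t = height y)"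
    if xy: "x \<in> topspace X" "y \<in> topspace X" and t: "0 \<le> t" for x y t
  proof -
    let ?D = "d (retr x) (retr y)"
    have D: "0 \<le> ?D" "retr x = retr y \<longrightarrow> ?D = 0"
      using geodesic_dist[OF dG in_A in_A] by auto
    have dga: "d (retr x) (ga x y t) = min (max (t - height x) 0) ?D"
      unfolding ga_def by (rule dist_geodesic[OF dG in_A in_A]) simp
    have ga_end: "?D \<le> max (t - height x) 0 \<longrightarrow> ga x y t = retr y"
      unfolding ga_def using geodesic_end[OF dG in_A in_A] by blast
    have ga_start: "t \<le> height x \<longrightarrow> ga x y t = retr x"
      unfolding ga_def using geodesic_start[OF dG in_A in_A] by simp
    have h: "0 \<le> height x" "0 \<le> height y"
      using height_range xy by auto
    \<comment> \<open>Start in \<open>A\<close>, end in \<open>A\<close>, or both ends on the open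
      part of the arc. In each case one term under the maxima in \<open>gh\<close> drops out, and
      the rest is arithmetic with \<open>min\<close> and \<open>max\<close>.\<close>
    consider "height x = 0" | "height x \<noteq> 0" "height y = 0" | "height x \<noteq> 0" "height y \<noteq> 0"
      by blast
    then show ?thesis
    proof cases
      case 1
      then have g: "gh x y t = max (min (height y) (t - ?D)) 0"
        using t h by (simp add: gh_def)
      have "gh x y t = 0 \<or> ga x y t = c 0"
        using ga_end 1 t height_0_or_base[of y] by (auto simp: g max_def)
      then show ?thesis
        using 1 D dga ga_end h t unfolding d'_def g by (auto simp: min_def max_def)
    next
      case 2
      then have g: "gh x y t = max (height x - t) 0"
        by (simp add: gh_def)
      have "gh x y t = 0 \<or> ga x y t = c 0"
        using ga_start 2 height_0_or_base[of x] by (auto simp: g max_def)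
      then show ?thesis
        using 2 D dga ga_end h t unfolding d'_def g by (auto simp: min_def max_def)
    next
      case 3
      then have "retr x = c 0" "retr y = c 0"
        using height_0_or_base by blast+
      with D have b: "retr x = retr y" "?D = 0" "ga x y t = c 0"
        using ga_end by auto
      then have g: "gh x y t = max (height x - t) (min (height y) (height x + t))"
        using h t by (simp add: gh_def)
      have "d (retr x) (ga x y t) = 0"
        using dga b by simp
      then show ?thesis
        using b \<open>retr y = c 0\<close> h t unfolding d'_def g by (auto simp: min_def max_def)
    qed
  qed
  have "geodesic_structure X d' G'"
    unfolding geodesic_structure_def
  proof (intro conjI ballI allI impI)
    have rr: "continuous_map (prod_topology X X) (subtopology X A) (\<lambda>z. retr (fst z))"
      "continuous_map (prod_topology X X) (subtopology X A) (\<lambda>z. retr (snd z))"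
      using continuous_map_compose[OF continuous_map_fst cont_retr]
        continuous_map_compose[OF continuous_map_snd cont_retr] by (auto simp: o_def)
    have hh: "continuous_map (prod_topology X X) euclideanreal (\<lambda>z. height (fst z))"
      "continuous_map (prod_topology X X) euclideanreal (\<lambda>z. height (snd z))"
      using continuous_map_compose[OF continuous_map_fst cont_height]
        continuous_map_compose[OF continuous_map_snd cont_height] by (auto simp: o_def)
    show "continuous_map (prod_topology X X) euclideanreal (\<lambda>z. d' (fst z) (snd z))"
      unfolding d'_def by (intro continuous_intros continuous_map_geodesic_dist[OF dG] rr hh)
    let ?Z = "prod_topology (prod_topology X X) (top_of_set {0::real..})"
    have tt: "continuous_map ?Z euclideanreal snd"
      using continuous_map_snd[of "prod_topology X X" "top_of_set {0::real..}"]
      by (auto simp: continuous_map_in_subtopology)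
    note fstZ = continuous_map_compose[OF continuous_map_fst[of "prod_topology X X" "top_of_set {0::real..}"],
        unfolded o_def]
    have ga: "continuous_map ?Z (subtopology X A) (\<lambda>z. ga (fst (fst z)) (snd (fst z)) (snd z))"
      unfolding ga_def
      by (intro continuous_map_geodesic[OF dG] continuous_intros fstZ[OF rr(1)] fstZ[OF rr(2)]
           fstZ[OF hh(1)] tt) auto
    have gh: "continuous_map ?Z euclideanreal (\<lambda>z. gh (fst (fst z)) (snd (fst z)) (snd z))"
      unfolding gh_def
      by (intro continuous_map_geodesic_dist[OF dG] continuous_intros fstZ[OF rr(1)] fstZ[OF rr(2)]
           fstZ[OF hh(1)] fstZ[OF hh(2)] tt)
    show "continuous_map ?Z X (\<lambda>z. G' (fst (fst z)) (snd (fst z)) (snd z))"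
      unfolding G'_def by (rule cont_point[OF ga gh]; intro conjI key[THEN conjunct1] gh_range) auto
  next
    fix x y
    assume xy: "x \<in> topspace X" "y \<in> topspace X"
    show "0 \<le> d' x y"
      using geodesic_dist(1)[OF dG in_A in_A] by (simp add: d'_def)
    have "d' x y = 0 \<longleftrightarrow> retr x = retr y \<and> height x = height y"
      using geodesic_dist[OF dG in_A in_A, of x y] unfolding d'_def by linarith
    then show "d' x y = 0 \<longleftrightarrow> x = y"
      using point_retr_height xy by metis
    fix t :: real
    assume t: "0 \<le> t"
    note k = key[OF xy t] and pt = retr_point[OF ga_in gh_range[OF xy t]]
      height_point[OF ga_in gh_range[OF xy t]]
    show "d' x (G' x y t) = min t (d' x y)"
      using k by (simp add: G'_def d'_def[of x "point _ _"] pt)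
    show "G' x y t = y" if "d' x y \<le> t"
      using k that point_retr_height[OF xy(2)] by (simp add: G'_def)
  qed
  then show ?thesis by blast
qed

end

section \<open>Trees\<close>

text \<open>Counts edges by one of their ends; applied to both ends, it yields the degree sum
  \<open>2 * card E\<close>.\<close>

lemma sum_card_fibres:
  assumes "finite V" "finite E" "\<And>e. e \<in> E \<Longrightarrow> f e \<in> V"
  shows "(\<Sum>v\<in>V. card {e \<in> E. f e = v}) = card E"
proof -
  have "card E = (\<Sum>v\<in>V. \<Sum>e | e \<in> E \<and> f e = v. 1)"
    unfolding card_eq_sum using assms by (intro sum.group[symmetric]) auto
  then show ?thesis by simp
qed

section \<open>Subcomplexes and leaves\<close>

locale cell_complex =
  fixes X :: "'a topology" and V :: "'a set" and E :: "'e set" and \<Phi> :: "'e \<Rightarrow> real \<Rightarrow> 'a"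
  assumes complex: "finite_cell_complex_1 X V E \<Phi>"
begin

lemma Hausdorff: "Hausdorff_space X"
  and finite_V: "finite V"
  and finite_E: "finite E"
  and topspace_eq: "topspace X = V \<union> (\<Union>e\<in>E. \<Phi> e ` {0<..<1})"
  using complex by (auto simp: finite_cell_complex_1_def)

lemma
  assumes "e \<in> E"
  shows cont: "continuous_map (top_of_set {0..1}) X (\<Phi> e)"
    and ends: "\<Phi> e 0 \<in> V" "\<Phi> e 1 \<in> V"
    and inj: "inj_on (\<Phi> e) {0<..<1}"
    and open_cell: "\<Phi> e ` {0<..<1} \<inter> V = {}"
  using complex assms by (auto simp: finite_cell_complex_1_def)

lemma open_cells_disjoint:
  "e \<in> E \<Longrightarrow> e' \<in> E \<Longrightarrow> e \<noteq> e' \<Longrightarrow> \<Phi> e ` {0<..<1} \<inter> \<Phi> e' ` {0<..<1} = {}"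
  using complex by (auto simp: finite_cell_complex_1_def)

lemma closed_cell_eq: "\<Phi> e ` {0..1} = insert (\<Phi> e 0) (insert (\<Phi> e 1) (\<Phi> e ` {0<..<1}))"
proof -
  have "{0..1} = insert 0 (insert 1 {0<..<1::real})"
    by auto
  then show ?thesis
    by (metis image_insert)
qed

text \<open>Closed cells are compact, hence closed, and there are finitely many. Replacing open
  cells by closed ones adds only endpoints, which already lie in \<open>W\<close>.\<close>

lemma closedin_subcomplex:
  assumes "W \<subseteq> V" "F \<subseteq> E" "\<And>e. e \<in> F \<Longrightarrow> \<Phi> e 0 \<in> W \<and> \<Phi> e 1 \<in> W"
  shows "closedin X (W \<union> (\<Union>e\<in>F. \<Phi> e ` {0<..<1}))"
proof -
  have "closedin X (\<Phi> e ` {0..1})" if "e \<in> E" for e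
    by (rule compactin_imp_closedin[OF Hausdorff image_compactin[OF _ cont[OF that]]])
       (simp add: compactin_subtopology)
  then have "closedin X (\<Union>e\<in>F. \<Phi> e ` {0..1})"
    using assms(2) finite_subset[OF assms(2) finite_E] by (intro closedin_Union) auto
  moreover have "closedin X W"
    by (rule closedin_Hausdorff_finite[OF Hausdorff])
       (use assms(1) finite_V topspace_eq finite_subset in auto)
  ultimately have "closedin X (W \<union> (\<Union>e\<in>F. \<Phi> e ` {0..1}))"
    by (rule closedin_Un[rotated])
  moreover have "W \<union> (\<Union>e\<in>F. \<Phi> e ` {0..1}) = W \<union> (\<Union>e\<in>F. \<Phi> e ` {0<..<1})"
    using assms(3) by (auto simp: closed_cell_eq)
  ultimately show ?thesis by simp
qed

lemma subcomplex:
  assumes "W \<subseteq> V" "F \<subseteq> E" "\<And>e. e \<in> F \<Longrightarrow> \<Phi> e 0 \<in> W \<and> \<Phi> e 1 \<in> W"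
  shows "finite_cell_complex_1 (subtopology X (W \<union> (\<Union>e\<in>F. \<Phi> e ` {0<..<1}))) W F \<Phi>"
proof -
  let ?A = "W \<union> (\<Union>e\<in>F. \<Phi> e ` {0<..<1})"
  have top: "topspace (subtopology X ?A) = ?A"
    using assms topspace_eq by auto
  have "continuous_map (top_of_set {0..1}) (subtopology X ?A) (\<Phi> e)" if "e \<in> F" for e
  proof (rule continuous_map_into_subtopology[OF cont])
    have "\<Phi> e ` {0..1} \<subseteq> ?A"
      using assms(3)[OF that] that by (auto simp: closed_cell_eq)
    then show "\<Phi> e \<in> topspace (top_of_set {0..1}) \<rightarrow> ?A"
      by auto
  qed (use that assms in auto)
  moreover have "finite W" "finite F"
    using assms finite_V finite_E finite_subset by blast+
  moreover have "\<Phi> e ` {0<..<1} \<inter> W = {}" if "e \<in> F" for e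
    using that assms(1,2) open_cell[of e] by blast
  ultimately show ?thesis
    unfolding finite_cell_complex_1_def top
    using assms(2,3) Hausdorff_space_subtopology[OF Hausdorff] inj open_cells_disjoint
    by (intro conjI ballI impI) (simp_all add: subset_iff)
qed

text \<open>An isolated vertex would be a clopen point, and the endpoints number twice the edges.\<close>

lemma exists_leaf:
  assumes "connected_space X" "E \<noteq> {}" "card V = card E + 1"
  shows "\<exists>v\<in>V. card {e \<in> E. \<Phi> e 0 = v} + card {e \<in> E. \<Phi> e 1 = v} = 1"
proof (rule ccontr)
  \<comment> \<open>A loop counts twice, so degree 1 means a single edge whose other end is a
    different vertex.\<close>
  let ?deg = "\<lambda>v. card {e \<in> E. \<Phi> e 0 = v} + card {e \<in> E. \<Phi> e 1 = v}"
  assume not: "\<not> ?thesis"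
  have "2 \<le> ?deg v" if v: "v \<in> V" for v
  proof (rule ccontr)
    assume "\<not> 2 \<le> ?deg v"
    moreover have "?deg v \<noteq> 1"
      using not v by blast
    ultimately have "?deg v = 0"
      by linarith
    then have no_end: "\<Phi> e 0 \<noteq> v \<and> \<Phi> e 1 \<noteq> v" if "e \<in> E" for e
      using finite_E that by auto
    \<comment> \<open>The complement of \<open>v\<close>. As no edge ends at \<open>v\<close>, it is
      a subcomplex and hence closed; it contains an open cell because \<open>E\<close> is
      nonempty.\<close>
    let ?B = "(V - {v}) \<union> (\<Union>e\<in>E. \<Phi> e ` {0<..<1})"
    have "\<not> connected_space X"
      unfolding connected_space_closedin not_not
    proof (intro exI conjI)
      show "closedin X {v}"
        using closedin_Hausdorff_singleton[OF Hausdorff] v topspace_eq by auto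
      show "closedin X ?B"
        by (rule closedin_subcomplex) (use no_end ends in auto)
      show "topspace X \<subseteq> {v} \<union> ?B"
        using topspace_eq by auto
      show "{v} \<inter> ?B = {}"
        using open_cell v by auto
      show "?B \<noteq> {}"
        using assms(2) by auto
    qed simp
    with assms(1) show False by blast
  qed
  then have "(\<Sum>v\<in>V. 2) \<le> (\<Sum>v\<in>V. ?deg v)"
    by (rule sum_mono)
  also have "\<dots> = 2 * card E"
    using sum_card_fibres[OF finite_V finite_E, of "\<lambda>e. \<Phi> e 0"]
      sum_card_fibres[OF finite_V finite_E, of "\<lambda>e. \<Phi> e 1"] ends
    by (simp add: sum.distrib)
  finally show False
    using assms(3) by simp
qed

text \<open>Removing the leaf \<open>v\<close> together with its open edge leaves a subcomplex that
  meets the closed edge only in its other end. The leaf sits at parameter 1 because an arc is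
  attached at parameter 0.\<close>

lemma arc_attached_leaf:
  assumes e: "e \<in> E" and v: "\<Phi> e 1 = v" "\<Phi> e 0 \<noteq> v"
    and others: "\<And>e'. e' \<in> E - {e} \<Longrightarrow> \<Phi> e' 0 \<noteq> v \<and> \<Phi> e' 1 \<noteq> v"
  shows "arc_attached X (V - {v} \<union> (\<Union>e\<in>E - {e}. \<Phi> e ` {0<..<1})) (\<Phi> e)"
proof
  let ?A = "V - {v} \<union> (\<Union>e\<in>E - {e}. \<Phi> e ` {0<..<1})"
  show "Hausdorff_space X"
    by (rule Hausdorff)
  show "closedin X ?A"
    by (rule closedin_subcomplex) (use others ends in auto)
  show "continuous_map (top_of_set {0..1}) X (\<Phi> e)"
    by (rule cont[OF e])
  have notin: "\<Phi> e t \<notin> V" if "t \<in> {0<..<1}" for t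
    using open_cell[OF e] that by blast
  show "inj_on (\<Phi> e) {0..1}"
  proof (rule inj_onI)
    fix s t :: real
    assume st: "s \<in> {0..1}" "t \<in> {0..1}" "\<Phi> e s = \<Phi> e t"
    \<comment> \<open>An endpoint goes to a vertex and an interior parameter does not, so mixed
      cases are impossible; the two endpoints are separated by \<open>v\<close>.\<close>
    then consider "s \<in> {0<..<1}" "t \<in> {0<..<1}" | "s \<in> {0, 1}" "t \<in> {0, 1}"
      using notin[of s] notin[of t] ends[OF e] by fastforce
    then show "s = t"
      using inj_onD[OF inj[OF e] st(3)] st(3) v by cases auto
  qed
  show "topspace X = ?A \<union> \<Phi> e ` {0..1}"
    using e ends[OF e] v topspace_eq by (auto simp: closed_cell_eq)
  have "\<Phi> e ` {0<..<1} \<inter> ?A = {}"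
    using open_cell[OF e] open_cells_disjoint[OF e] by blast
  moreover have "\<Phi> e 1 \<notin> ?A" "\<Phi> e 0 \<in> ?A"
    using v ends[OF e] open_cell by auto
  ultimately show "?A \<inter> \<Phi> e ` {0..1} = {\<Phi> e 0}"
    by (auto simp: closed_cell_eq)
qed

end

section \<open>Induction over trees by pruning leaves\<close>

lemma arc_attached_connected:
  assumes "arc_attached X A c" "connected_space X"
  shows "connected_space (subtopology X A)"
proof -
  interpret arc_attached X A c by fact
  \<comment> \<open>As a retract of \<open>X\<close>, the part left after pruning is a continuous
    image of a connected space.\<close>
  have "retr ` topspace X = A"
    using retr_A retr_in A_subset by force
  then show ?thesis
    using connectedin_continuous_map_image[OF cont_retr, of "topspace X"] assms(2)
    by (simp add: connectedin_def subtopology_subtopology)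
qed

text \<open>Allows a leaf at parameter 0 of its edge to be moved to parameter 1.\<close>

lemma finite_cell_complex_1_reverse_edge:
  assumes "finite_cell_complex_1 X V E \<Phi>"
  shows "finite_cell_complex_1 X V E (\<Phi>(e := (\<lambda>t. \<Phi> e (1 - t))))"
proof -
  interpret cell_complex X V E \<Phi>
    using assms by unfold_locales
  let ?\<Psi> = "\<Phi>(e := (\<lambda>t. \<Phi> e (1 - t)))"
  have im: "?\<Psi> e' ` {0<..<1} = \<Phi> e' ` {0<..<1}" for e'
  proof -
    have "t \<in> (\<lambda>t. 1 - t) ` {0<..<1}" if "t \<in> {0<..<1}" for t :: real
      by (rule image_eqI[of _ _ "1 - t"]) (use that in auto)
    then have "(\<lambda>t. 1 - t) ` {0<..<1::real} = {0<..<1}"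
      by auto
    then have "(\<lambda>t. \<Phi> e (1 - t)) ` {0<..<1} = \<Phi> e ` {0<..<1}"
      by (metis image_image)
    then show ?thesis by simp
  qed
  have "continuous_map (top_of_set {0..1}) X (?\<Psi> e')" if "e' \<in> E" for e'
  proof (cases "e' = e")
    case True
    have "continuous_map (top_of_set {0..1}) (top_of_set {0..1::real}) (\<lambda>t. 1 - t)"
      by (auto intro!: continuous_intros)
    from continuous_map_compose[OF this cont[OF that]] True show ?thesis
      by (simp add: o_def)
  qed (use cont[OF that] in auto)
  moreover have "inj_on (?\<Psi> e') {0<..<1}" if "e' \<in> E" for e'
  proof (cases "e' = e")
    case True
    show ?thesis
    proof (rule inj_onI)
      fix s t :: real
      assume st: "s \<in> {0<..<1}" "t \<in> {0<..<1}" "?\<Psi> e' s = ?\<Psi> e' t"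
      have "1 - s = 1 - t"
        by (rule inj_onD[OF inj[OF that]]) (use st True in auto)
      then show "s = t" by simp
    qed
  qed (use inj[OF that] in auto)
  moreover have "?\<Psi> e' 0 \<in> V" "?\<Psi> e' 1 \<in> V" if "e' \<in> E" for e'
    using ends[OF that] by auto
  ultimately show ?thesis
    unfolding finite_cell_complex_1_def im
    using Hausdorff finite_V finite_E topspace_eq open_cell open_cells_disjoint
    by (intro conjI ballI impI) simp_all
qed

text \<open>Induction on the number of edges: pruning a leaf loses one vertex and one edge, so the
  Euler characteristic stays 1. The predicate sees only the space, not the cell structure.\<close>

lemma tree_induct:
  assumes "graph X V E \<Phi>" "euler_char V E = 1"
    and point: "\<And>X v. topspace X = {v} \<Longrightarrow> P X"
    and attach: "\<And>X A c. arc_attached X A c \<Longrightarrow> P (subtopology X A) \<Longrightarrow> P X"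
  shows "P X"
  using assms(1,2)
proof (induction "card E" arbitrary: X V E \<Phi>)
  case 0
  interpret cell_complex X V E \<Phi>
    using "0.prems" by unfold_locales (simp add: graph_def)
  have "E = {}"
    using "0.hyps" finite_E by simp
  moreover from this have "card V = 1"
    using "0.prems"(2) by (simp add: euler_char_def)
  then obtain v where "V = {v}"
    by (rule card_1_singletonE)
  ultimately have "topspace X = {v}"
    using topspace_eq by simp
  then show ?case
    by (rule point)
next
  case (Suc k)
  \<comment> \<open>Stated for arbitrary characteristic maps \<open>\<Psi>\<close>, so that it
    applies both to \<open>\<Phi>\<close> and to \<open>\<Phi>\<close> with one edge
    reversed.\<close>
  have leaf_last: "P X"
    if gr: "graph X V E \<Psi>" and e: "e \<in> E" and v: "v \<in> V" "\<Psi> e 1 = v" "\<Psi> e 0 \<noteq> v"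
      and others: "\<And>e'. e' \<in> E - {e} \<Longrightarrow> \<Psi> e' 0 \<noteq> v \<and> \<Psi> e' 1 \<noteq> v" for \<Psi> e v
  proof -
    interpret cell_complex X V E \<Psi>
      using gr by unfold_locales (simp add: graph_def)
    let ?A = "V - {v} \<union> (\<Union>e\<in>E - {e}. \<Psi> e ` {0<..<1})"
    have arc: "arc_attached X ?A (\<Psi> e)"
      by (rule arc_attached_leaf) (use e v others in auto)
    have "finite_cell_complex_1 (subtopology X ?A) (V - {v}) (E - {e}) \<Psi>"
      by (rule subcomplex) (use others ends in auto)
    moreover have "connected_space (subtopology X ?A)"
      by (rule arc_attached_connected[OF arc]) (use gr in \<open>simp add: graph_def\<close>)
    moreover have "topspace (subtopology X ?A) \<noteq> {}"
      using arc_attached.topspace_A[OF arc] arc_attached.base_in[OF arc] by auto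
    ultimately have "graph (subtopology X ?A) (V - {v}) (E - {e}) \<Psi>"
      by (simp add: graph_def)
    moreover have "card V \<ge> 1"
      using v finite_V by (metis One_nat_def Suc_leI card_gt_0_iff empty_iff)
    then have "euler_char (V - {v}) (E - {e}) = 1"
      using Suc.hyps(2) Suc.prems(2) e v by (simp add: euler_char_def of_nat_diff)
    moreover have "k = card (E - {e})"
      using Suc.hyps(2) e by simp
    ultimately have "P (subtopology X ?A)"
      using Suc.hyps(1) by blast
    then show ?thesis
      by (rule attach[OF arc])
  qed
  interpret cell_complex X V E \<Phi>
    using Suc.prems by unfold_locales (simp add: graph_def)
  have "E \<noteq> {}" "card V = card E + 1"
    using Suc by (auto simp: euler_char_def)
  then obtain v where v: "v \<in> V"
    and "card {e \<in> E. \<Phi> e 0 = v} + card {e \<in> E. \<Phi> e 1 = v} = 1"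
    using exists_leaf Suc.prems(1) by (auto simp: graph_def)
  then consider "card {e \<in> E. \<Phi> e 1 = v} = 1" "card {e \<in> E. \<Phi> e 0 = v} = 0"
    | "card {e \<in> E. \<Phi> e 0 = v} = 1" "card {e \<in> E. \<Phi> e 1 = v} = 0"
    by linarith
  then show ?case
  proof cases
    case 1
    then obtain e where e: "{e \<in> E. \<Phi> e 1 = v} = {e}" and "{e \<in> E. \<Phi> e 0 = v} = {}"
      using finite_E by (auto simp: card_1_singleton_iff)
    then show ?thesis
      using Suc.prems(1) v by (intro leaf_last[of \<Phi> e v]) blast+
  next
    case 2
    then obtain e where e: "{e \<in> E. \<Phi> e 0 = v} = {e}" and "{e \<in> E. \<Phi> e 1 = v} = {}"
      using finite_E by (auto simp: card_1_singleton_iff)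
    moreover have "graph X V E (\<Phi>(e := (\<lambda>t. \<Phi> e (1 - t))))"
      using Suc.prems(1) finite_cell_complex_1_reverse_edge by (auto simp: graph_def)
    ultimately show ?thesis
      using v by (intro leaf_last[of "\<Phi>(e := (\<lambda>t. \<Phi> e (1 - t)))" e v]) auto
  qed
qed

lemma tree_fixed_point_property:
  assumes "graph X V E \<Phi>" "euler_char V E = 1"
  shows "fixed_point_property X"
  using assms
proof (rule tree_induct)
  show "fixed_point_property X" if "topspace X = {v}" for X :: "'a topology" and v
    using that by (auto simp: fixed_point_property_def continuous_map_def)
qed (rule arc_attached.fixed_point_property_arc_attached)

lemma tree_geodesic_structure:
  assumes "graph X V E \<Phi>" "euler_char V E = 1"
  shows "\<exists>d G. geodesic_structure X d G"
  using assms
proof (rule tree_induct)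
  show "\<exists>d G. geodesic_structure X d G" if "topspace X = {v}" for X :: "'a topology" and v
  proof -
    have "continuous_map (prod_topology (prod_topology X X) (top_of_set {0..})) X (\<lambda>z. fst (fst z))"
      using continuous_map_compose[OF continuous_map_fst continuous_map_fst] by (simp add: o_def)
    with that have "geodesic_structure X (\<lambda>_ _. 0) (\<lambda>x _ _. x)"
      by (auto simp: geodesic_structure_def)
    then show ?thesis by blast
  qed
qed (use arc_attached.geodesic_structure_arc_attached in blast)

section \<open>Sections of the forgetting map\<close>

lemma topspace_Conf:
  "x \<in> topspace (Conf n X) \<longleftrightarrow> x \<in> (\<Pi>\<^sub>E i\<in>{1..n}. topspace X) \<and> inj_on x {1..n}"
  by (auto simp: Conf_def inj_on_def)

lemma continuous_map_into_Conf:
  assumes "\<And>z. z \<in> topspace Z \<Longrightarrow> f z \<in> extensional {1..n} \<and> inj_on (f z) {1..n}"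
    and "\<And>i. i \<in> {1..n} \<Longrightarrow> continuous_map Z X (\<lambda>z. f z i)"
  shows "continuous_map Z (Conf n X) f"
  unfolding Conf_def
proof (rule continuous_map_into_subtopology)
  show "continuous_map Z (product_topology (\<lambda>_. X) {1..n}) f"
    using assms by (simp add: continuous_map_componentwise image_subset_iff)
  show "f \<in> topspace Z \<rightarrow> {x. \<forall>i\<in>{1..n}. \<forall>j\<in>{1..n}. i \<noteq> j \<longrightarrow> x i \<noteq> x j}"
    using assms(1) unfolding inj_on_def by blast
qed

lemma continuous_map_Conf_coord:
  "i \<in> {1..n} \<Longrightarrow> continuous_map (Conf n X) X (\<lambda>x. x i)"
  unfolding Conf_def
  by (intro continuous_map_from_subtopology continuous_map_product_projection)

text \<open>Identify \<open>X\<close> with \<open>Conf 1 X\<close> through \<open>?i\<close>. The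
  second coordinate of a section is then a continuous self-map of \<open>X\<close>; it moves every
  \<open>a\<close>, because the first coordinate is \<open>a\<close> and the two are
  distinct.\<close>

lemma no_section_1:
  assumes "fixed_point_property X" "continuous_map (Conf 1 X) (Conf 2 X) s"
    and sec: "\<And>x. x \<in> topspace (Conf 1 X) \<Longrightarrow> forget 1 (s x) = x"
  shows False
proof -
  let ?i = "\<lambda>a. \<lambda>i\<in>{1..1::nat}. a"
  have i: "continuous_map X (Conf 1 X) ?i"
    by (rule continuous_map_into_Conf) (auto simp: inj_on_def)
  have "continuous_map X X (\<lambda>a. s (?i a) 2)"
    using continuous_map_compose[OF i continuous_map_compose[OF assms(2) continuous_map_Conf_coord]]
    by (simp add: o_def)
  with assms(1) obtain a where a: "a \<in> topspace X" "s (?i a) 2 = a"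
    unfolding fixed_point_property_def by blast
  have ia: "?i a \<in> topspace (Conf 1 X)"
    using continuous_map_funspace[OF i] a by auto
  have "s (?i a) 1 = a"
    using fun_cong[OF sec[OF ia], of 1] by (simp add: forget_def)
  moreover have "inj_on (s (?i a)) {1..2}"
    using continuous_map_funspace[OF assms(2)] ia by (auto simp: topspace_Conf)
  ultimately show False
    using a by (auto dest: inj_onD[of _ _ 1 2])
qed

lemma section_of_geodesic_structure:
  assumes dG: "geodesic_structure X d G" and n: "2 \<le> n"
  shows "\<exists>s. continuous_map (Conf n X) (Conf (n + 1) X) s \<and>
             (\<forall>x\<in>topspace (Conf n X). forget n (s x) = x)"
proof -
  \<comment> \<open>A continuous positive quantity below every \<open>d (x 1) (x j)\<close>: its
    reciprocal exceeds each \<open>1 / d (x 1) (x j)\<close>. The summand 1 makes this strict even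
    for \<open>n = 2\<close>, where the sum has a single term.\<close>
  define r where "r x = 1 / (1 + (\<Sum>j\<in>{2..n}. 1 / d (x 1) (x j)))" for x :: "nat \<Rightarrow> 'a"
  define y where "y x = G (x 1) (x 2) (r x)" for x
  define s where "s x = (\<lambda>i\<in>{1..n + 1}. if i = n + 1 then y x else x i)" for x
  have coord: "x i \<in> topspace X" if "x \<in> topspace (Conf n X)" "i \<in> {1..n}" for x i
    using that by (auto simp: topspace_Conf)
  have pos: "0 < d (x 1) (x j)" if x: "x \<in> topspace (Conf n X)" and j: "j \<in> {2..n}" for x j
  proof -
    have "inj_on x {1..n}"
      using x by (simp add: topspace_Conf)
    then have "x 1 \<noteq> x j"
      using j by (auto dest: inj_onD[of _ _ 1 j])
    moreover have "x 1 \<in> topspace X" "x j \<in> topspace X"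
      using coord[OF x] j by auto
    ultimately show ?thesis
      using geodesic_dist[OF dG, of "x 1" "x j"] by simp
  qed
  have sum_nonneg': "0 \<le> (\<Sum>j\<in>{2..n}. 1 / d (x 1) (x j))" if "x \<in> topspace (Conf n X)" for x
    using pos[OF that] by (intro sum_nonneg) (simp add: less_imp_le)
  have r_pos: "0 < r x" if "x \<in> topspace (Conf n X)" for x
    using sum_nonneg'[OF that] by (simp add: r_def)
  have r_less: "r x < d (x 1) (x j)" if x: "x \<in> topspace (Conf n X)" and j: "j \<in> {2..n}" for x j
  proof -
    have "1 / d (x 1) (x j) \<le> (\<Sum>j\<in>{2..n}. 1 / d (x 1) (x j))"
      using pos[OF x] j by (intro member_le_sum) (auto simp: less_imp_le)
    then have "1 / d (x 1) (x j) < 1 + (\<Sum>j\<in>{2..n}. 1 / d (x 1) (x j))"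
      by simp
    then show ?thesis
      using pos[OF x j] sum_nonneg'[OF x] by (simp add: r_def field_simps)
  qed
  have y_neq: "y x \<noteq> x i" if x: "x \<in> topspace (Conf n X)" and i: "i \<in> {1..n}" for x i
  proof
    assume "y x = x i"
    have x12: "x 1 \<in> topspace X" "x 2 \<in> topspace X"
      using coord[OF x] n by auto
    \<comment> \<open>Since \<open>r x < d (x 1) (x 2)\<close>, the geodesic has not stopped by time
      \<open>r x\<close>. So \<open>y x\<close> is at distance exactly \<open>r x\<close> from
      \<open>x 1\<close>, while \<open>x 1\<close> is at distance 0 and every other
      \<open>x i\<close> is farther away.\<close>
    then have "d (x 1) (y x) = r x"
      using dist_geodesic[OF dG x12, of "r x"] r_pos[OF x] r_less[OF x, of 2] n
      by (simp add: y_def)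
    moreover have "d (x 1) (x 1) = 0"
      using geodesic_dist(2)[OF dG x12(1) x12(1)] by simp
    ultimately show False
      using \<open>y x = x i\<close> r_pos[OF x] r_less[OF x, of i] i by (cases "i = 1") auto
  qed
  have cont_r: "continuous_map (Conf n X) euclideanreal r"
    unfolding r_def
    using n pos sum_nonneg'
    by (intro continuous_intros continuous_map_geodesic_dist[OF dG] continuous_map_Conf_coord)
       (fastforce simp: add_nonneg_eq_0_iff)+
  have cont_y: "continuous_map (Conf n X) X y"
    unfolding y_def
    by (intro continuous_map_geodesic[OF dG] continuous_map_Conf_coord cont_r)
       (use n r_pos in \<open>auto intro: less_imp_le\<close>)
  have "continuous_map (Conf n X) (Conf (n + 1) X) s"
  proof (rule continuous_map_into_Conf)
    show "s x \<in> extensional {1..n + 1} \<and> inj_on (s x) {1..n + 1}"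
      if x: "x \<in> topspace (Conf n X)" for x
    proof
      show "inj_on (s x) {1..n + 1}"
      proof (rule inj_onI)
        fix i j
        assume ij: "i \<in> {1..n + 1}" "j \<in> {1..n + 1}" "s x i = s x j"
        have "inj_on x {1..n}"
          using x by (simp add: topspace_Conf)
        then show "i = j"
          using ij y_neq[OF x, of i] y_neq[OF x, of j]
          by (cases "i = n + 1"; cases "j = n + 1") (auto simp: s_def dest: inj_onD)
      qed
    qed (simp add: s_def)
    show "continuous_map (Conf n X) X (\<lambda>x. s x i)" if "i \<in> {1..n + 1}" for i
      using that cont_y continuous_map_Conf_coord[of i n X]
      by (cases "i = n + 1") (auto simp: s_def)
  qed
  \<comment> \<open>Equality of total functions: outside \<open>{1..n}\<close> both sides are
    \<open>undefined\<close>, as points of \<open>Conf n X\<close> are extensional.\<close>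
  moreover have "forget n (s x) = x" if "x \<in> topspace (Conf n X)" for x
    using that by (auto simp: forget_def s_def topspace_Conf PiE_iff extensional_def fun_eq_iff)
  ultimately show ?thesis by blast
qed

theorem theorem1p3:
  fixes X :: "'a topology" and V :: "'a set" and E :: "'e set"
    and \<Phi> :: "'e \<Rightarrow> real \<Rightarrow> 'a" and n :: nat
  assumes "graph X V E \<Phi>"
    and "euler_char V E = 1"
    and "n \<ge> 1"
  shows "(\<exists>s. continuous_map (Conf n X) (Conf (n + 1) X) s \<and>
              (\<forall>x\<in>topspace (Conf n X). forget n (s x) = x)) \<longleftrightarrow> n \<ge> 2"
proof
  assume "\<exists>s. continuous_map (Conf n X) (Conf (n + 1) X) s \<and>
              (\<forall>x\<in>topspace (Conf n X). forget n (s x) = x)"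
  moreover have "n = 1" if "\<not> 2 \<le> n"
    using assms(3) that by simp
  ultimately show "n \<ge> 2"
    using no_section_1[OF tree_fixed_point_property[OF assms(1,2)]]
    by (metis nat_1_add_1)
next
  assume "n \<ge> 2"
  with tree_geodesic_structure[OF assms(1,2)] section_of_geodesic_structure
  show "\<exists>s. continuous_map (Conf n X) (Conf (n + 1) X) s \<and>
            (\<forall>x\<in>topspace (Conf n X). forget n (s x) = x)"
    by blast
qed

end
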